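(* Let $p$ be a prime. Let $G\cong\mathbb{Z}_p^{r_1}\oplus\mathbb{Z}_{p^2}^{r_2}\oplus\cdots\oplus\mathbb{Z}_{p^e}^{r_e}$ with $e\geq1$, $r_i\geq0$ for $1\leq i\leq e-1$, $r_e\geq1$. Let $\Gamma$ be the group with signature given by the $p$-datum $(x_1,\dots,x_f;h)$, where $h\geq 0$, $f\geq 0$, and $x_f>0$ if $f\geq 1$, and let $H=\Gamma/[\Gamma,\Gamma]$. Suppose that $f'=f\leq e$, that in case $p=2$ and $e'<f$ additionally $x_f$ is even, and that $$2h+\sum_{j=i}^f x_j\geq 1+\sum_{j=i}^e r_j\quad\text{for }1\leq i\leq f,\qquad\text{and}\qquad 2h\geq\sum_{j=f+1}^e r_j.$$ Then there exists a smooth epimorphism $\varphi:H\to G$.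
   Context: The group $\Gamma$ with $p$-datum $(x_1,\dots,x_f;h)$ ($x_i\in\mathbb{N}_0$; for $f=0$ the datum is $(-;h)$) is generated by $a_k,b_k$ ($1\leq k\leq h$) and $c_{ij}$ ($1\leq i\leq f$, $1\leq j\leq x_i$), subject to $c_{ij}^{p^i}=1$ and $\prod_{k=1}^h[a_k,b_k]\cdot\prod_{i=1}^f\prod_{j=1}^{x_i}c_{ij}=1$. Elements of $\Gamma$ are identified with their images in $H=\Gamma/[\Gamma,\Gamma]$. An epimorphism $\varphi:H\to G$ is called smooth if $\varphi(c_{ij})$ has order $p^i$ for all $1\leq i\leq f$, $1\leq j\leq x_i$, and (if $f\geq1$) $\prod_{j=1}^{x_f-1}\varphi(c_{fj})$ has order $p^f$. $f'$: put $f'=0$ if $\sum_{i=1}^f x_i\leq1$, and $f'=\max\{1\leq d\leq f:\sum_{i=d}^f x_i\geq2\}$ otherwise. $e'$: put $e'=0$ if $\sum_{i=1}^e r_i\leq1$, and $e'=\max\{1\leq d\leq e:\sum_{i=d}^e r_i\geq2\}$ otherwise. *)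

theory Defs
  imports "HOL-Algebra.Product_Groups" "HOL-Algebra.Generated_Groups"
    "HOL-Algebra.Multiplicative_Group" "HOL-Computational_Algebra.Primes"
begin

text \<open>A letter \<open>(x, True)\<close> stands for the generator \<open>x\<close>, and \<open>(x, False)\<close> for its inverse.\<close>

type_synonym 'g word = "('g \<times> bool) list"

definition words :: "'g set \<Rightarrow> 'g word set" where
  "words X = {w. fst ` set w \<subseteq> X}"

definition inv_word :: "'g word \<Rightarrow> 'g word" where
  "inv_word w = rev (map (\<lambda>(x, s). (x, \<not> s)) w)"

inductive_set pres_rel :: "'g set \<Rightarrow> 'g word set \<Rightarrow> ('g word \<times> 'g word) set"
  for X :: "'g set" and R :: "'g word set" where
  refl: "u \<in> words X \<Longrightarrow> (u, u) \<in> pres_rel X R"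
| sym: "(u, v) \<in> pres_rel X R \<Longrightarrow> (v, u) \<in> pres_rel X R"
| trans: "(u, v) \<in> pres_rel X R \<Longrightarrow> (v, w) \<in> pres_rel X R \<Longrightarrow> (u, w) \<in> pres_rel X R"
| cancel: "u \<in> words X \<Longrightarrow> v \<in> words X \<Longrightarrow> x \<in> X
    \<Longrightarrow> (u @ [(x, s), (x, \<not> s)] @ v, u @ v) \<in> pres_rel X R"
| relator: "u \<in> words X \<Longrightarrow> v \<in> words X \<Longrightarrow> r \<in> R \<Longrightarrow> r \<in> words X
    \<Longrightarrow> (u @ r @ v, u @ v) \<in> pres_rel X R"

definition presented_group :: "'g set \<Rightarrow> 'g word set \<Rightarrow> 'g word set monoid" where
  "presented_group X R =
     \<lparr>carrier = words X // pres_rel X R,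
      monoid.mult = (\<lambda>U V. \<Union>u\<in>U. \<Union>v\<in>V. pres_rel X R `` {u @ v}),
      one = pres_rel X R `` {[]}\<rparr>"

definition gen_class :: "'g set \<Rightarrow> 'g word set \<Rightarrow> 'g \<Rightarrow> 'g word set" where
  "gen_class X R x = pres_rel X R `` {[(x, True)]}"

lemma words_append [simp]: "u @ v \<in> words X \<longleftrightarrow> u \<in> words X \<and> v \<in> words X"
  by (auto simp: words_def)

lemma words_Nil [simp]: "[] \<in> words X"
  by (auto simp: words_def)

lemma words_Cons [simp]: "a # w \<in> words X \<longleftrightarrow> fst a \<in> X \<and> w \<in> words X"
  by (auto simp: words_def)

lemma inv_word_in_words [simp]: "inv_word w \<in> words X \<longleftrightarrow> w \<in> words X"
  by (induction w) (auto simp: inv_word_def)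

lemma pres_rel_words: "(u, v) \<in> pres_rel X R \<Longrightarrow> u \<in> words X \<and> v \<in> words X"
  by (induction rule: pres_rel.induct) auto

lemma equiv_pres_rel: "equiv (words X) (pres_rel X R)"
  by (auto intro!: equivI refl_onI symI transI intro: pres_rel.intros dest: pres_rel_words)

lemma pres_rel_context:
  assumes "(u, v) \<in> pres_rel X R" "a \<in> words X" "b \<in> words X"
  shows "(a @ u @ b, a @ v @ b) \<in> pres_rel X R"
  using assms
proof (induction rule: pres_rel.induct)
  case (cancel u v x s)
  then show ?case using pres_rel.cancel[of "a @ u" X "v @ b" x s R] by simp
next
  case (relator u v r)
  then show ?case using pres_rel.relator[of "a @ u" X "v @ b" r R] by simp
qed (auto intro: pres_rel.intros)

lemma pres_rel_append:
  assumes "(u, u') \<in> pres_rel X R" "(v, v') \<in> pres_rel X R"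
  shows "(u @ v, u' @ v') \<in> pres_rel X R"
  using pres_rel_context[OF assms(1), of "[]" v] pres_rel_context[OF assms(2), of u' "[]"]
    pres_rel_words[OF assms(1)] pres_rel_words[OF assms(2)] pres_rel.trans
  by fastforce

lemma presented_group_mult:
  assumes "u \<in> words X" "v \<in> words X"
  shows "pres_rel X R `` {u} \<otimes>\<^bsub>presented_group X R\<^esub> pres_rel X R `` {v} = pres_rel X R `` {u @ v}"
proof -
  have "(\<lambda>u v. pres_rel X R `` {u @ v}) respects2 pres_rel X R"
    using equiv_pres_rel
    by (auto simp: congruent2_def intro!: equiv_class_eq[OF equiv_pres_rel] pres_rel_append)
  from UN_equiv_class2[OF equiv_pres_rel equiv_pres_rel this assms] show ?thesis
    by (simp add: presented_group_def)
qed

lemma pres_rel_inv: "w \<in> words X \<Longrightarrow> (inv_word w @ w, []) \<in> pres_rel X R"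
proof (induction w)
  case Nil
  then show ?case by (auto simp: inv_word_def intro: pres_rel.refl)
next
  case (Cons a w)
  obtain x s where a: "a = (x, s)" by force
  have "(inv_word w @ [(x, \<not> s), (x, \<not> \<not> s)] @ w, inv_word w @ w) \<in> pres_rel X R"
    using Cons.prems a by (intro pres_rel.cancel) auto
  with Cons show ?case by (auto simp: a inv_word_def intro: pres_rel.trans)
qed

lemma group_presented_group: "group (presented_group X R)"
proof (rule groupI)
  have carr: "carrier (presented_group X R) = words X // pres_rel X R"
    and one: "\<one>\<^bsub>presented_group X R\<^esub> = pres_rel X R `` {[]}"
    by (simp_all add: presented_group_def)
  show "\<one>\<^bsub>presented_group X R\<^esub> \<in> carrier (presented_group X R)"
    by (simp add: carr one quotientI)
  fix U assume "U \<in> carrier (presented_group X R)"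
  then obtain u where u: "u \<in> words X" "U = pres_rel X R `` {u}"
    by (auto simp: carr elim: quotientE)
  show "\<one>\<^bsub>presented_group X R\<^esub> \<otimes>\<^bsub>presented_group X R\<^esub> U = U"
    using u by (simp add: one presented_group_mult)
  have "pres_rel X R `` {inv_word u} \<otimes>\<^bsub>presented_group X R\<^esub> U = \<one>\<^bsub>presented_group X R\<^esub>"
    using u equiv_class_eq[OF equiv_pres_rel pres_rel_inv]
    by (simp add: one presented_group_mult)
  moreover have "pres_rel X R `` {inv_word u} \<in> carrier (presented_group X R)"
    using u by (simp add: carr quotientI)
  ultimately show "\<exists>V\<in>carrier (presented_group X R).
      V \<otimes>\<^bsub>presented_group X R\<^esub> U = \<one>\<^bsub>presented_group X R\<^esub>" by blast
  fix V assume "V \<in> carrier (presented_group X R)"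
  then obtain v where v: "v \<in> words X" "V = pres_rel X R `` {v}"
    by (auto simp: carr elim: quotientE)
  show "U \<otimes>\<^bsub>presented_group X R\<^esub> V \<in> carrier (presented_group X R)"
    using u v by (simp add: presented_group_mult carr quotientI)
  fix W assume "W \<in> carrier (presented_group X R)"
  then obtain w where w: "w \<in> words X" "W = pres_rel X R `` {w}"
    by (auto simp: carr elim: quotientE)
  show "U \<otimes>\<^bsub>presented_group X R\<^esub> V \<otimes>\<^bsub>presented_group X R\<^esub> W =
      U \<otimes>\<^bsub>presented_group X R\<^esub> (V \<otimes>\<^bsub>presented_group X R\<^esub> W)"
    using u v w by (simp add: presented_group_mult)
qed

text \<open>A \<open>p\<close>-datum \<open>(x\<^sub>1,\<dots>,x\<^sub>f; h)\<close> is encoded by \<open>f\<close>, a function \<open>x\<close> of which only the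
  values \<open>x 1, \<dots>, x f\<close> are used, and \<open>h\<close>.\<close>

datatype datum_gen = Gen_a nat | Gen_b nat | Gen_c nat nat

definition datum_gens :: "nat \<Rightarrow> (nat \<Rightarrow> nat) \<Rightarrow> nat \<Rightarrow> datum_gen set" where
  "datum_gens f x h =
     Gen_a ` {1..h} \<union> Gen_b ` {1..h} \<union> {Gen_c i j | i j. i \<in> {1..f} \<and> j \<in> {1..x i}}"

definition comm_word :: "'g \<Rightarrow> 'g \<Rightarrow> 'g word" where
  "comm_word a b = [(a, True), (b, True), (a, False), (b, False)]"

definition long_relator :: "nat \<Rightarrow> (nat \<Rightarrow> nat) \<Rightarrow> nat \<Rightarrow> datum_gen word" where
  "long_relator f x h =
     concat (map (\<lambda>k. comm_word (Gen_a k) (Gen_b k)) [1..<Suc h]) @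
     concat (map (\<lambda>i. map (\<lambda>j. (Gen_c i j, True)) [1..<Suc (x i)]) [1..<Suc f])"

definition datum_rels :: "nat \<Rightarrow> nat \<Rightarrow> (nat \<Rightarrow> nat) \<Rightarrow> nat \<Rightarrow> datum_gen word set" where
  "datum_rels p f x h =
     insert (long_relator f x h)
       {replicate (p ^ i) (Gen_c i j, True) | i j. i \<in> {1..f} \<and> j \<in> {1..x i}}"

definition datum_group :: "nat \<Rightarrow> nat \<Rightarrow> (nat \<Rightarrow> nat) \<Rightarrow> nat \<Rightarrow> datum_gen word set monoid" where
  "datum_group p f x h = presented_group (datum_gens f x h) (datum_rels p f x h)"

definition abelianization :: "('a, 'b) monoid_scheme \<Rightarrow> 'a set monoid" where
  "abelianization G = G Mod derived G (carrier G)"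

definition c_elt :: "nat \<Rightarrow> nat \<Rightarrow> (nat \<Rightarrow> nat) \<Rightarrow> nat \<Rightarrow> nat \<Rightarrow> nat \<Rightarrow> datum_gen word set" where
  "c_elt p f x h i j = gen_class (datum_gens f x h) (datum_rels p f x h) (Gen_c i j)"

definition c_ab :: "nat \<Rightarrow> nat \<Rightarrow> (nat \<Rightarrow> nat) \<Rightarrow> nat \<Rightarrow> nat \<Rightarrow> nat \<Rightarrow> datum_gen word set set" where
  "c_ab p f x h i j =
     derived (datum_group p f x h) (carrier (datum_group p f x h))
       #>\<^bsub>datum_group p f x h\<^esub> c_elt p f x h i j"

definition smooth_epi ::
  "nat \<Rightarrow> nat \<Rightarrow> (nat \<Rightarrow> nat) \<Rightarrow> nat \<Rightarrow> ('a, 'b) monoid_scheme \<Rightarrow> (datum_gen word set set \<Rightarrow> 'a) \<Rightarrow> bool"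
  where
  "smooth_epi p f x h G \<phi> \<longleftrightarrow>
     \<phi> \<in> epi (abelianization (datum_group p f x h)) G \<and>
     (\<forall>i\<in>{1..f}. \<forall>j\<in>{1..x i}. group.ord G (\<phi> (c_ab p f x h i j)) = p ^ i) \<and>
     (f \<ge> 1 \<longrightarrow>
        group.ord G (\<Otimes>\<^bsub>G\<^esub>j\<in>{1..x f - 1}. \<phi> (c_ab p f x h f j)) = p ^ f)"

text \<open>\<open>f'\<close> is \<open>prime_index f x\<close> and \<open>e'\<close> is \<open>prime_index e r\<close>.\<close>

definition prime_index :: "nat \<Rightarrow> (nat \<Rightarrow> nat) \<Rightarrow> nat" where
  "prime_index n y =
     (if (\<Sum>i=1..n. y i) \<le> 1 then 0 else Max {d \<in> {1..n}. (\<Sum>i=d..n. y i) \<ge> 2})"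

definition abelian_p_group :: "nat \<Rightarrow> nat \<Rightarrow> (nat \<Rightarrow> nat) \<Rightarrow> (nat \<times> nat \<Rightarrow> int) monoid" where
  "abelian_p_group p e r =
     sum_group (SIGMA i:{1..e}. {1..r i}) (\<lambda>(i, k). integer_mod_group (p ^ i))"

end

theory Submission
  imports Defs
begin

text \<open>
  Smooth epimorphisms onto \<open>G\<close> amount to elements \<open>A k\<close>, \<open>B k\<close>, \<open>C (i, j)\<close> generating \<open>G\<close> such that
  \<open>C (i, j)\<close> has order \<open>p\<^sup>i\<close> and the product of all \<open>C (i, j)\<close> is trivial. The last smoothness
  condition is then automatic: the power with exponent \<open>N = p ^ (f - 1)\<close> of this product only
  involves the factors with \<open>i = f\<close>.

  Sort the cyclic factors of \<open>G\<close> by decreasing order and match them first with the \<open>2h\<close> free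
  generators and then with the \<open>c\<^sub>i\<^sub>j\<close>, sorted by decreasing \<open>i\<close>, one \<open>c\<^sub>f\<^sub>j\<close> being set aside. By the
  counting hypotheses every basis element has at most the order prescribed for its partner, and
  multiplying by a power of the first basis element \<open>u\<close> corrects the order without changing the
  generated subgroup. The generator set aside must become the inverse of the product \<open>S\<close> of the
  others, so \<open>S\<close> has to have order \<open>p\<^sup>f\<close>. If it does not, one of the elements of order \<open>p\<^sup>f\<close> is
  replaced by another admissible one with a different \<open>N\<close>-th power: by its inverse if \<open>p\<close> is odd,
  and by a correction with \<open>u\<close> or with the second basis element if \<open>p = 2\<close>; the parity hypothesis
  ensures that this second element has order at least \<open>p\<^sup>f\<close> when it is needed.
\<close>

subsection \<open>Homomorphisms out of presented groups\<close>

definition (in monoid) word_eval :: "('g \<Rightarrow> 'a) \<Rightarrow> 'g word \<Rightarrow> 'a" where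
  "word_eval F w = foldr (\<lambda>(x, s) a. (if s then F x else inv (F x)) \<otimes> a) w \<one>"

context group
begin

lemma word_eval_Nil [simp]: "word_eval F [] = \<one>"
  and word_eval_Cons [simp]:
    "word_eval F ((x, s) # w) = (if s then F x else inv (F x)) \<otimes> word_eval F w"
  by (simp_all add: word_eval_def)

lemma word_eval_closed [simp]:
  assumes "F \<in> X \<rightarrow> carrier G" "w \<in> words X"
  shows "word_eval F w \<in> carrier G"
  using assms(2) by (induction w) (use assms(1) in \<open>auto simp: Pi_iff\<close>)

lemma word_eval_append:
  assumes F: "F \<in> X \<rightarrow> carrier G" and "u \<in> words X" "v \<in> words X"
  shows "word_eval F (u @ v) = word_eval F u \<otimes> word_eval F v"
  using assms(2)
proof (induction u)
  case Nil
  show ?case using word_eval_closed[OF F \<open>v \<in> words X\<close>] by simp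
next
  case (Cons a u)
  obtain x s where a: "a = (x, s)" by force
  have "x \<in> X" "u \<in> words X" using Cons.prems by (auto simp: a)
  then have "F x \<in> carrier G" "word_eval F u \<in> carrier G" "word_eval F v \<in> carrier G"
    using F word_eval_closed[OF F] assms(3) by auto
  then show ?case using Cons by (simp add: a m_assoc)
qed

text \<open>Each rule generating \<open>pres_rel\<close> leaves the value of a word unchanged.
  Relators outside \<open>words X\<close> never enter a rule, so only those over \<open>X\<close>
  have to evaluate to \<open>\<one>\<close>.\<close>

lemma word_eval_respects:
  assumes "(u, v) \<in> pres_rel X R" and F: "F \<in> X \<rightarrow> carrier G"
    and R: "\<And>r. r \<in> R \<Longrightarrow> r \<in> words X \<Longrightarrow> word_eval F r = \<one>"
  shows "word_eval F u = word_eval F v"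
  using assms(1)
proof (induction rule: pres_rel.induct)
  case (cancel u v x s)
  have Fx: "F x \<in> carrier G" using F cancel by auto
  have c: "word_eval F v \<in> carrier G" using word_eval_closed[OF F] cancel by auto
  have "word_eval F ([(x, s), (x, \<not> s)] @ v) = word_eval F v"
    using Fx c by (simp add: m_assoc[symmetric])
  moreover have "[(x, s), (x, \<not> s)] @ v \<in> words X" using cancel by simp
  ultimately show ?case
    using cancel by (simp only: word_eval_append[OF F])
next
  case (relator u v r)
  have c: "word_eval F v \<in> carrier G" using word_eval_closed[OF F] relator by auto
  have "r @ v \<in> words X" using relator by simp
  then show ?case using relator R c by (simp add: word_eval_append[OF F])
qed auto

text \<open>Von Dyck's theorem: evaluation of words is constant on classes once the relators
  evaluate to \<open>\<one>\<close>.\<close>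

lemma presented_group_lift:
  assumes F: "F \<in> X \<rightarrow> carrier G"
    and R: "\<And>r. r \<in> R \<Longrightarrow> r \<in> words X \<Longrightarrow> word_eval F r = \<one>"
  obtains \<psi> where "\<psi> \<in> hom (presented_group X R) G"
    and "\<And>x. x \<in> X \<Longrightarrow> \<psi> (gen_class X R x) = F x"
proof
  \<comment> \<open>The image of a class under evaluation is a singleton, so \<open>the_elem\<close>
    returns the common value.\<close>
  define \<psi> where "\<psi> U = the_elem (word_eval F ` U)" for U
  have \<psi>: "\<psi> (pres_rel X R `` {u}) = word_eval F u" if u: "u \<in> words X" for u
  proof -
    have "word_eval F ` (pres_rel X R `` {u}) = {word_eval F u}"
      using word_eval_respects[OF _ F R] pres_rel.refl[OF u] by force
    then show ?thesis by (simp add: \<psi>_def)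
  qed
  show "\<psi> \<in> hom (presented_group X R) G"
  proof (rule homI)
    fix U assume "U \<in> carrier (presented_group X R)"
    then obtain u where u: "u \<in> words X" "U = pres_rel X R `` {u}"
      by (auto simp: presented_group_def elim: quotientE)
    then show "\<psi> U \<in> carrier G" by (simp add: \<psi> word_eval_closed[OF F])
    fix V assume "V \<in> carrier (presented_group X R)"
    then obtain v where v: "v \<in> words X" "V = pres_rel X R `` {v}"
      by (auto simp: presented_group_def elim: quotientE)
    show "\<psi> (U \<otimes>\<^bsub>presented_group X R\<^esub> V) = \<psi> U \<otimes> \<psi> V"
      using u v by (simp add: presented_group_mult \<psi> word_eval_append[OF F])
  qed
  show "\<psi> (gen_class X R x) = F x" if "x \<in> X" for x
    using that F by (auto simp: gen_class_def \<psi> Pi_iff)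
qed

end

lemma gen_class_in_carrier: "x \<in> X \<Longrightarrow> gen_class X R x \<in> carrier (presented_group X R)"
  by (simp add: gen_class_def presented_group_def quotientI)

text \<open>As \<open>G\<close> is abelian, the homomorphism from von Dyck's theorem kills the
  derived subgroup and factors through the quotient. Its image is a subgroup containing a generating
  set, hence all of \<open>G\<close>.\<close>

lemma (in comm_group) abelianized_presented_group_lift:
  fixes X :: "'g set" and R
  defines "P \<equiv> presented_group X R"
  assumes F: "F \<in> X \<rightarrow> carrier G"
    and R: "\<And>r. r \<in> R \<Longrightarrow> r \<in> words X \<Longrightarrow> word_eval F r = \<one>"
    and gen: "generate G (F ` X) = carrier G"
  obtains \<phi> where "\<phi> \<in> epi (abelianization P) G"
    and "\<And>x. x \<in> X \<Longrightarrow> \<phi> (derived P (carrier P) #>\<^bsub>P\<^esub> gen_class X R x) = F x"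
proof -
  obtain \<psi> where \<psi>: "\<psi> \<in> hom P G" "\<And>x. x \<in> X \<Longrightarrow> \<psi> (gen_class X R x) = F x"
    using presented_group_lift[OF F R] unfolding P_def by blast
  have grpP: "group P" unfolding P_def by (rule group_presented_group)
  interpret gh: group_hom P G \<psi>
    by (simp add: group_hom_def group_hom_axioms_def grpP is_group \<psi>)
  have "\<psi> ` derived P (carrier P) = derived G (\<psi> ` carrier P)"
    by (rule gh.derived_img[symmetric]) simp
  also have "\<dots> = {\<one>}"
    by (rule derived_eq_singleton) auto
  finally have ker: "derived P (carrier P) \<subseteq> kernel P G \<psi>"
    using gh.G.derived_in_carrier[of "carrier P"] by (auto simp: kernel_def)
  obtain \<phi> where \<phi>: "\<phi> \<in> hom (P Mod derived P (carrier P)) G"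
    "\<And>x. x \<in> carrier P \<Longrightarrow> \<phi> (derived P (carrier P) #>\<^bsub>P\<^esub> x) = \<psi> x"
    using gh.FactGroup_universal_kernel[OF gh.G.derived_self_is_normal ker] by blast
  have gc: "gen_class X R x \<in> carrier P" if "x \<in> X" for x
    using gen_class_in_carrier[OF that] by (simp add: P_def)
  have val: "\<phi> (derived P (carrier P) #>\<^bsub>P\<^esub> gen_class X R x) = F x" if "x \<in> X" for x
    using \<phi>(2) \<psi>(2) gc that by simp
  have "F ` X \<subseteq> \<psi> ` carrier P" using \<psi>(2) gc by force
  then have "generate G (F ` X) \<subseteq> \<psi> ` carrier P"
    by (rule generate_subgroup_incl[OF _ gh.img_is_subgroup])
  moreover have "\<psi> ` carrier P \<subseteq> \<phi> ` carrier (P Mod derived P (carrier P))"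
    using \<phi>(2) by (force simp: carrier_FactGroup)
  ultimately have "\<phi> ` carrier (P Mod derived P (carrier P)) = carrier G"
    using gen \<phi>(1) by (auto simp: hom_def)
  then have "\<phi> \<in> epi (abelianization P) G" using \<phi>(1) by (simp add: epi_def abelianization_def)
  then show thesis using that val by blast
qed

subsection \<open>Pairs of indices in increasing order\<close>

text \<open>A list, because the second half of \<open>long_relator\<close> runs through the
  generators in this order and because positions in the reversed list are counted later.\<close>

definition index_pairs :: "nat \<Rightarrow> (nat \<Rightarrow> nat) \<Rightarrow> (nat \<times> nat) list" where
  "index_pairs n y = concat (map (\<lambda>i. map (\<lambda>j. (i, j)) [1..<Suc (y i)]) [1..<Suc n])"

lemma index_pairs_Suc:
  "index_pairs (Suc n) y = index_pairs n y @ map (\<lambda>j. (Suc n, j)) [1..<Suc (y (Suc n))]"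
  by (simp add: index_pairs_def)

lemma index_pairs_0 [simp]: "index_pairs 0 y = []"
  by (simp add: index_pairs_def)

lemma set_index_pairs: "set (index_pairs n y) = (SIGMA i:{1..n}. {1..y i})"
  by (fastforce simp: index_pairs_def)

lemma distinct_index_pairs: "distinct (index_pairs n y)"
  by (induction n) (auto simp: index_pairs_Suc set_index_pairs distinct_map inj_on_def)

lemma sorted_index_pairs: "sorted (map fst (index_pairs n y))"
  by (induction n) (auto simp: index_pairs_Suc set_index_pairs sorted_append comp_def map_replicate_const)

lemma length_filter_index_pairs:
  assumes "i \<ge> 1"
  shows "length (filter (\<lambda>l. fst l \<ge> i) (index_pairs n y)) = (\<Sum>j=i..n. y j)"
proof (induction n)
  case 0
  then show ?case using assms by simp
next
  case (Suc n)
  then show ?case using assms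
    by (auto simp: index_pairs_Suc filter_map comp_def not_less_eq_eq)
qed

text \<open>In the reversed list the keys decrease, so the entries with key at least
  \<open>i\<close> form an initial segment, as long as the filtered list.\<close>

lemma rev_sorted_nth_ge_iff:
  fixes i :: "'b::linorder"
  assumes "sorted (map k xs)" "n < length xs"
  shows "k (rev xs ! n) \<ge> i \<longleftrightarrow> n < length (filter (\<lambda>l. k l \<ge> i) xs)"
  using assms
proof (induction xs arbitrary: n rule: rev_induct)
  case (snoc a xs)
  show ?case
  proof (cases "k a \<ge> i")
    case True
    then show ?thesis using snoc by (cases n) (auto simp: sorted_append)
  next
    case False
    then have "\<forall>l\<in>set xs. \<not> k l \<ge> i" using snoc.prems by (force simp: sorted_append)
    moreover have "rev (xs @ [a]) ! n \<in> set (xs @ [a])"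
      using snoc.prems by (metis length_rev nth_mem set_rev)
    ultimately have "\<not> k (rev (xs @ [a]) ! n) \<ge> i" "filter (\<lambda>l. k l \<ge> i) (xs @ [a]) = []"
      using False by (auto simp: filter_empty_conv)
    then show ?thesis by (metis list.size(3) not_less_zero)
  qed
qed simp

subsection \<open>Smooth epimorphisms from generators\<close>

context comm_group
begin

section \<open>Evaluation of the relators in an abelian group\<close>

lemma word_eval_positive:
  assumes "distinct zs" "inj_on t (set zs)" "F \<in> t ` set zs \<rightarrow> carrier G"
  shows "word_eval F (map (\<lambda>z. (t z, True)) zs) = (\<Otimes>z\<in>set zs. F (t z))"
  using assms by (induction zs) (auto simp: Pi_iff finprod_insert)

lemma word_eval_replicate:
  assumes "F x \<in> carrier G"
  shows "word_eval F (replicate n (x, True)) = F x [^] n"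
  by (induction n) (use assms nat_pow_Suc2 in auto)

lemma word_eval_comm_words:
  assumes "F \<in> (\<lambda>k. fst (t k)) ` set ks \<union> (\<lambda>k. snd (t k)) ` set ks \<rightarrow> carrier G"
  shows "word_eval F (concat (map (\<lambda>k. comm_word (fst (t k)) (snd (t k))) ks)) = \<one>"
  using assms
proof (induction ks)
  case (Cons k ks)
  have "F (fst (t k)) \<in> carrier G" "F (snd (t k)) \<in> carrier G" using Cons.prems by auto
  then have "F (fst (t k)) \<otimes> (F (snd (t k)) \<otimes> (inv F (fst (t k)) \<otimes> inv F (snd (t k)))) = \<one>"
    by (simp add: m_assoc[symmetric] inv_mult[symmetric])
  then show ?case using Cons by (simp add: comm_word_def)
qed simp

text \<open>The order is some \<open>p ^ k\<close> with \<open>k \<le> i\<close>, and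
  \<open>k < i\<close> would make the smaller power trivial.\<close>

lemma ord_prime_powerI:
  assumes "prime (p::nat)" "a \<in> carrier G" "i \<ge> 1" "a [^] (p ^ i) = \<one>" "a [^] (p ^ (i - 1)) \<noteq> \<one>"
  shows "ord a = p ^ i"
proof -
  have "ord a dvd p ^ i" using assms pow_eq_id by simp
  then obtain k where k: "k \<le> i" "ord a = p ^ k"
    using divides_primepow_nat[OF assms(1)] by blast
  have "\<not> k \<le> i - 1"
  proof
    assume "k \<le> i - 1"
    then have "ord a dvd p ^ (i - 1)" using k by (simp add: le_imp_power_dvd)
    then show False using assms pow_eq_id by simp
  qed
  then have "k = i" using k(1) by simp
  with k(2) show ?thesis by simp
qed

lemma nat_pow_finprod:
  fixes n :: nat
  assumes "F \<in> A \<rightarrow> carrier G"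
  shows "(\<Otimes>z\<in>A. F z) [^] n = (\<Otimes>z\<in>A. F z [^] n)"
  using assms
proof (induction A rule: infinite_finite_induct)
  case (insert z A)
  then show ?case by (subst (1 2) finprod_insert) (auto simp: nat_pow_distrib)
qed auto

text \<open>The long relator evaluates to \<open>\<one>\<close> by commutativity and
  \<open>prod\<close>, the power relators by \<open>ord\<close>. So von Dyck's theorem applies, and
  \<open>gen\<close> gives surjectivity.\<close>

lemma smooth_epi_exists:
  fixes A B :: "nat \<Rightarrow> 'a" and C :: "nat \<times> nat \<Rightarrow> 'a"
  assumes p: "prime p" and f: "f \<ge> 1 \<Longrightarrow> x f \<ge> 1"
    and A: "A \<in> {1..h} \<rightarrow> carrier G" and B: "B \<in> {1..h} \<rightarrow> carrier G"
    and C: "C \<in> (SIGMA i:{1..f}. {1..x i}) \<rightarrow> carrier G"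
    and ord: "\<And>i j. i \<in> {1..f} \<Longrightarrow> j \<in> {1..x i} \<Longrightarrow> ord (C (i, j)) = p ^ i"
    and prod: "(\<Otimes>l\<in>(SIGMA i:{1..f}. {1..x i}). C l) = \<one>"
    and gen: "carrier G \<subseteq> generate G (A ` {1..h} \<union> B ` {1..h} \<union> C ` (SIGMA i:{1..f}. {1..x i}))"
  shows "\<exists>\<phi>. smooth_epi p f x h G \<phi>"
proof -
  let ?I = "SIGMA i:{1..f}. {1..x i}"
  define F where "F = case_datum_gen A B (\<lambda>i j. C (i, j))"
  define X where "X = datum_gens f x h"
  define R where "R = datum_rels p f x h"
  have X: "X = Gen_a ` {1..h} \<union> Gen_b ` {1..h} \<union> (\<lambda>l. Gen_c (fst l) (snd l)) ` ?I"
    by (force simp: X_def datum_gens_def)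
  have FX: "F ` X = A ` {1..h} \<union> B ` {1..h} \<union> C ` ?I"
    by (simp add: X image_Un image_image F_def)
  have F: "F \<in> X \<rightarrow> carrier G" using A B C by (auto simp: X_def datum_gens_def F_def)
  have eval: "word_eval F r = \<one>" if "r \<in> R" "r \<in> words X" for r
  proof (cases "r = long_relator f x h")
    case True
    \<comment> \<open>The pairs are left unreduced to match \<open>word_eval_comm_words\<close> with
      \<open>t k = (Gen_a k, Gen_b k)\<close>.\<close>
    let ?u = "concat (map (\<lambda>k. comm_word (fst (Gen_a k, Gen_b k)) (snd (Gen_a k, Gen_b k))) [1..<Suc h])"
    let ?v = "map (\<lambda>l. (Gen_c (fst l) (snd l), True)) (index_pairs f x)"
    have r: "r = ?u @ ?v"
      by (simp add: True long_relator_def index_pairs_def map_concat comp_def)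
    then have "word_eval F r = word_eval F ?u \<otimes> word_eval F ?v"
      using that(2) by (simp only: words_append word_eval_append[OF F])
    also have "word_eval F ?u = \<one>"
      by (rule word_eval_comm_words) (use A B in \<open>auto simp: F_def\<close>)
    also have "word_eval F ?v = (\<Otimes>l\<in>?I. F (Gen_c (fst l) (snd l)))"
      unfolding set_index_pairs[symmetric]
      by (rule word_eval_positive)
        (use C in \<open>auto simp: distinct_index_pairs inj_on_def set_index_pairs F_def Pi_iff\<close>)
    also have "\<dots> = \<one>" using prod by (simp add: F_def)
    finally show ?thesis by simp
  next
    case False
    then obtain i j where ij: "r = replicate (p ^ i) (Gen_c i j, True)" "i \<in> {1..f}" "j \<in> {1..x i}"
      using \<open>r \<in> R\<close> by (auto simp: R_def datum_rels_def)
    then have "C (i, j) \<in> carrier G" using C by auto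
    then show ?thesis using ij ord[of i j] by (simp add: word_eval_replicate F_def pow_eq_id)
  qed
  have "F ` X \<subseteq> carrier G" using F by auto
  from generate_incl[OF this] have gen': "generate G (F ` X) = carrier G"
    using gen by (simp add: FX)
  obtain \<phi> where \<phi>: "\<phi> \<in> epi (abelianization (presented_group X R)) G"
    "\<And>g. g \<in> X \<Longrightarrow> \<phi> (derived (presented_group X R) (carrier (presented_group X R))
        #>\<^bsub>presented_group X R\<^esub> gen_class X R g) = F g"
    using abelianized_presented_group_lift[OF F eval gen'] by blast
  have c: "\<phi> (c_ab p f x h i j) = C (i, j)" if "i \<in> {1..f}" "j \<in> {1..x i}" for i j
    using \<phi>(2)[of "Gen_c i j"] that
    by (auto simp: c_ab_def c_elt_def datum_group_def X_def R_def datum_gens_def F_def)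
  have "ord (\<Otimes>j\<in>{1..x f - 1}. \<phi> (c_ab p f x h f j)) = p ^ f" if f1: "f \<ge> 1"
  proof -
    define D where "D = (\<Otimes>j\<in>{1..x f - 1}. C (f, j))"
    have Cf: "C (f, j) \<in> carrier G" if "j \<in> {1..x f}" for j using C f1 that by auto
    have Cp: "C (f, j) [^] (p ^ f) = \<one>" if "j \<in> {1..x f}" for j
      using ord[of f j] Cf that f1 by (simp add: pow_eq_id)
    have D: "D \<in> carrier G" unfolding D_def by (rule finprod_closed) (use Cf in auto)
    have Dp: "D [^] (p ^ f) = \<one>"
      unfolding D_def by (subst nat_pow_finprod) (use Cf Cp in \<open>auto intro!: finprod_one_eqI\<close>)
    let ?N = "p ^ (f - 1)"
    \<comment> \<open>Raise the product relation to the power \<open>N\<close>. For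
      \<open>i < f\<close> the order \<open>p ^ i\<close> divides \<open>N\<close>, so only the
      factors with \<open>i = f\<close> survive.\<close>
    have "\<one> = (\<Otimes>l\<in>?I. C l [^] ?N)"
      by (subst nat_pow_finprod[OF C, symmetric]) (simp only: prod nat_pow_one)
    also have "\<dots> = (\<Otimes>l\<in>Pair f ` {1..x f}. C l [^] ?N)"
    proof (rule finprod_mono_neutral_cong_right)
      show "\<And>l. l \<in> ?I - Pair f ` {1..x f} \<Longrightarrow> C l [^] ?N = \<one>"
      proof -
        fix l assume "l \<in> ?I - Pair f ` {1..x f}"
        moreover obtain i j where "l = (i, j)" by force
        ultimately have l: "l = (i, j)" "i \<in> {1..f}" "j \<in> {1..x i}" "i \<noteq> f"
          by auto
        then have "i < f" by (simp add: le_neq_implies_less)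
        then have "i \<le> f - 1" by simp
        then have "p ^ i dvd ?N" by (simp add: le_imp_power_dvd)
        moreover have "C l \<in> carrier G" using C l by auto
        ultimately show "C l [^] ?N = \<one>" using ord[of i j] l by (simp add: pow_eq_id)
      qed
    qed (use C f1 in auto)
    also have "\<dots> = (\<Otimes>j\<in>{1..x f}. C (f, j) [^] ?N)"
      by (subst finprod_reindex) (use Cf in \<open>auto simp: inj_on_def\<close>)
    also have "{1..x f} = insert (x f) {1..x f - 1}" using f f1 by auto
    also have "(\<Otimes>j\<in>insert (x f) {1..x f - 1}. C (f, j) [^] ?N)
        = C (f, x f) [^] ?N \<otimes> (\<Otimes>j\<in>{1..x f - 1}. C (f, j) [^] ?N)"
      by (rule finprod_insert) (use Cf f f1 in auto)
    also have "(\<Otimes>j\<in>{1..x f - 1}. C (f, j) [^] ?N) = D [^] ?N"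
      unfolding D_def by (rule nat_pow_finprod[symmetric]) (use Cf in auto)
    finally have eq: "C (f, x f) [^] ?N \<otimes> D [^] ?N = \<one>" by simp
    \<comment> \<open>\<open>C (f, x f)\<close> has order \<open>p ^ f\<close>, so its
      \<open>N\<close>-th power is nontrivial; by \<open>eq\<close> the same then holds for
      \<open>D\<close>.\<close>
    have "\<not> p ^ f dvd ?N"
      using f1 prime_gt_1_nat[OF p] by (simp add: power_dvd_imp_le dvd_power_iff_le prime_ge_2_nat[OF p])
    then have "C (f, x f) [^] ?N \<noteq> \<one>"
      using ord[of f "x f"] Cf[of "x f"] f f1 by (simp add: pow_eq_id)
    then have "D [^] ?N \<noteq> \<one>" using eq Cf[of "x f"] f f1 by auto
    then have "ord D = p ^ f" by (rule ord_prime_powerI[OF p D f1 Dp])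
    moreover have "(\<Otimes>j\<in>{1..x f - 1}. \<phi> (c_ab p f x h f j)) = D"
      unfolding D_def by (rule finprod_cong') (use c f1 Cf in auto)
    ultimately show ?thesis by simp
  qed
  then have "smooth_epi p f x h G \<phi>"
    using \<phi>(1) ord c by (auto simp: smooth_epi_def datum_group_def X_def R_def)
  then show ?thesis by blast
qed

subsection \<open>Generating systems with prescribed orders\<close>

text \<open>Recovers a basis element from its corrected version once the correcting factor is known
  to lie in the subgroup.\<close>

lemma subgroup_cancel_right:
  assumes H: "subgroup H G" and "a \<in> carrier G" "w \<in> H" "a \<otimes> w \<in> H"
  shows "a \<in> H"
proof -
  have "(a \<otimes> w) \<otimes> inv w \<in> H"
    using assms by (simp add: subgroup.m_closed subgroup.m_inv_closed)
  then show ?thesis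
    using assms subgroup.mem_carrier[OF H \<open>w \<in> H\<close>] by (simp add: m_assoc)
qed

lemma subgroup_nat_pow_closed:
  assumes "subgroup H G" "a \<in> H"
  shows "a [^] (n::nat) \<in> H"
  by (induction n) (use assms in \<open>auto simp: subgroup.one_closed subgroup.m_closed\<close>)

text \<open>
  The generators with index below \<open>m\<close> are free; those with index in \<open>{m..<M}\<close> get order \<open>p ^ d n\<close>,
  the first \<open>q\<close> of these being the ones with \<open>d n = f\<close>. The sequence \<open>b\<close> is padded with \<open>\<one>\<close>.
\<close>

lemma generators_of_prescribed_orders:
  fixes b :: "nat \<Rightarrow> 'a" and s d :: "nat \<Rightarrow> nat"
  assumes p: "prime p"
    and b: "\<And>n. b n \<in> carrier G" and b_ord: "\<And>n. ord (b n) = p ^ s n"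
    and gen: "carrier G \<subseteq> generate G (b ` {..<M})"
    and s0: "s 0 = e" and s1: "\<And>n. n \<ge> 1 \<Longrightarrow> s n \<le> s 1"
    and q: "q \<ge> 1" "m + q \<le> M" and f: "f \<ge> 1" "f \<le> e"
    and d_top: "\<And>n. n \<in> {m..<m + q} \<Longrightarrow> d n = f"
    and d_low: "\<And>n. n \<in> {m + q..<M} \<Longrightarrow> 1 \<le> d n \<and> d n < f"
    and sd: "\<And>n. n \<in> {m..<M} \<Longrightarrow> s n \<le> d n"
    and two: "p = 2 \<Longrightarrow> s 1 < f \<Longrightarrow> odd q"
    and indep: "\<And>n. n \<ge> 1 \<Longrightarrow> s n \<ge> 1 \<Longrightarrow> b n [^] (p ^ (s n - 1)) \<noteq> b 0 [^] (p ^ (e - 1))"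
  obtains g where "\<And>n. n < M \<Longrightarrow> g n \<in> carrier G"
    and "carrier G \<subseteq> generate G (g ` {..<M})"
    and "\<And>n. n \<in> {m..<M} \<Longrightarrow> ord (g n) = p ^ d n"
    and "ord (\<Otimes>n\<in>{m..<M}. g n) = p ^ f"
proof -
  note result = that
  define u where "u = b 0"
  \<comment> \<open>An element of order \<open>p\<close>; it is the \<open>N\<close>-th power shared
    by all top elements that are corrected by \<open>u\<close>.\<close>
  define z where "z = u [^] (p ^ (e - 1))"
  define N where "N = p ^ (f - 1)"
  have p1: "p > 1" using prime_gt_1_nat[OF p] .
  have dvd_iff: "p ^ i dvd p ^ j \<longleftrightarrow> i \<le> j" for i j
    using p1 by (meson le_imp_power_dvd power_dvd_imp_le)
  have b_pow: "b n [^] (p ^ k) = \<one> \<longleftrightarrow> s n \<le> k" for n k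
    using b b_ord by (simp add: pow_eq_id dvd_iff)
  have u: "u \<in> carrier G" using b by (simp add: u_def)
  have z: "z \<in> carrier G" using u by (simp add: z_def)
  have pp: "(a [^] (p ^ i)) [^] (p ^ j) = a [^] (p ^ (i + j))" if "a \<in> carrier G" for a i j
    using that by (simp add: nat_pow_pow power_add)
  have z1: "z \<noteq> \<one>" using b_pow[of 0 "e - 1"] s0 f by (simp add: z_def u_def)
  have zp: "z [^] p = \<one>"
  proof -
    have "z [^] p = u [^] (p ^ (e - 1 + 1))" using pp[OF u, of "e - 1" 1] by (simp add: z_def)
    then show ?thesis using b_pow[of 0 e] s0 f by (simp add: u_def)
  qed
  have "ord z = p"
    using ord_prime_powerI[OF p z, of 1] zp z1 z by simp
  then have z_pow: "z [^] k = \<one> \<longleftrightarrow> p dvd k" for k :: nat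
    using z by (simp add: pow_eq_id)

  have d: "1 \<le> d n \<and> d n \<le> f" if "n \<in> {m..<M}" for n
    using that d_top[of n] d_low[of n] f by (cases "n < m + q") auto
  \<comment> \<open>\<open>u [^] (p ^ (e - d n))\<close> has order \<open>p ^ d n\<close>. For
    indices in \<open>{m..<M}\<close> a correction is made only if \<open>b n\<close> has smaller
    order, so the product gets the prescribed one.\<close>
  define g where "g n = (if n < m \<or> s n = d n then b n else b n \<otimes> u [^] (p ^ (e - d n)))" for n
  have g: "g n \<in> carrier G" for n using b u by (simp add: g_def)
  \<comment> \<open>Stated for arbitrary \<open>a\<close>, since \<open>u\<close> and later
    \<open>b 1\<close> serve as correcting elements. At exponent \<open>k - 1\<close> the factor
    \<open>b n\<close> has already vanished, so only \<open>a\<close> contributes.\<close>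
  have modify_ord: "ord (b n \<otimes> a [^] (p ^ (t - k))) = p ^ k"
    and modify_pow: "(b n \<otimes> a [^] (p ^ (t - k))) [^] (p ^ (k - 1)) = a [^] (p ^ (t - 1))"
    if "s n < k" "k \<le> t" "a \<in> carrier G" "a [^] (p ^ t) = \<one>" "a [^] (p ^ (t - 1)) \<noteq> \<one>"
    for n k t a
  proof -
    let ?a = "b n \<otimes> a [^] (p ^ (t - k))"
    have "?a [^] (p ^ k) = b n [^] (p ^ k) \<otimes> a [^] (p ^ (t - k + k))"
      using that b by (simp add: nat_pow_distrib pp)
    also have "\<dots> = \<one>" using that b_pow[of n k] by simp
    finally have 1: "?a [^] (p ^ k) = \<one>" .
    have "?a [^] (p ^ (k - 1)) = b n [^] (p ^ (k - 1)) \<otimes> a [^] (p ^ (t - k + (k - 1)))"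
      using that b by (simp add: nat_pow_distrib pp)
    also have "t - k + (k - 1) = t - 1" using that by simp
    also have "b n [^] (p ^ (k - 1)) = \<one>" using that b_pow[of n "k - 1"] by simp
    finally show 2: "?a [^] (p ^ (k - 1)) = a [^] (p ^ (t - 1))" using that by simp
    show "ord ?a = p ^ k"
      by (rule ord_prime_powerI[OF p]) (use that b 1 2 in auto)
  qed
  have ue: "u [^] (p ^ e) = \<one>" using b_pow[of 0 e] s0 by (simp add: u_def)
  have uz: "u [^] (p ^ (e - 1)) \<noteq> \<one>" using z1 by (simp add: z_def)
  have g_ord: "ord (g n) = p ^ d n" if n: "n \<in> {m..<M}" for n
  proof (cases "s n = d n")
    case True
    then show ?thesis by (simp add: g_def b_ord)
  next
    case False
    then have "s n < d n" using sd[OF n] by simp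
    then show ?thesis
      using modify_ord[OF _ _ u ue uz] d[OF n] f False n by (simp add: g_def)
  qed
  have g_top: "g n [^] N = z" if "n \<in> {m..<m + q}" "s n < f" for n
    using modify_pow[OF that(2) f(2) u ue uz] that d_top[OF that(1)] by (simp add: g_def N_def z_def)
  have g_top_neq: "g n [^] N \<noteq> \<one>" if "n \<in> {m..<m + q}" for n
    using g_ord[of n] d_top[OF that] that q g f by (simp add: N_def pow_eq_id dvd_iff)
  have g_low: "g n [^] N = \<one>" if "n \<in> {m + q..<M}" for n
    using g_ord[of n] d_low[OF that] that g by (auto simp: N_def pow_eq_id dvd_iff)
  \<comment> \<open>Without free generators index 0 lies in the top range, so
    \<open>e = s 0 \<le> d 0 = f\<close>.\<close>
  have m0: "e = f" if "m = 0"
    using sd[of 0] d_top[of 0] that q f s0 by simp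
  \<comment> \<open>Index 0 is either free or already of the prescribed order. Thus \<open>u\<close>
    itself stays among the generators and can be divided out of the corrections.\<close>
  have g0: "g 0 = u"
    using sd[of 0] d_top[of 0] m0 q s0 by (cases "m = 0") (simp_all add: g_def u_def)

  define S where "S = (\<Otimes>n\<in>{m..<M}. g n)"
  \<comment> \<open>The low indices vanish under the \<open>N\<close>-th power and each top index
    contributes \<open>z\<close>. Index 0 is top only if \<open>m = 0\<close>, and then
    \<open>e = f\<close> gives \<open>u [^] N = z\<close>.\<close>
  have S_pow: "S [^] N = z [^] q" if "\<And>n. n \<in> {m..<m + q} \<Longrightarrow> n = 0 \<or> s n < f"
  proof -
    have "S [^] N = (\<Otimes>n\<in>{m..<M}. g n [^] N)"
      unfolding S_def by (rule nat_pow_finprod) (use g in auto)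
    also have "\<dots> = (\<Otimes>n\<in>{m..<m + q}. z)"
    proof (rule finprod_mono_neutral_cong_right)
      show "g n [^] N = z" if n: "n \<in> {m..<m + q}" for n
        using \<open>\<And>n. n \<in> {m..<m + q} \<Longrightarrow> n = 0 \<or> s n < f\<close>[OF n] g_top[OF n] g0 m0 n
        by (auto simp: N_def z_def)
    qed (use q g g_low in auto)
    also have "\<dots> = z [^] q" using z by (simp add: finprod_const)
    finally show ?thesis .
  qed

  have generateI: "carrier G \<subseteq> generate G (k ` {..<M})"
    if k: "\<And>n. n < M \<Longrightarrow> k n \<in> carrier G"
      and bk: "\<And>n H. n < M \<Longrightarrow> subgroup H G \<Longrightarrow> (\<And>i. i < M \<Longrightarrow> k i \<in> H) \<Longrightarrow> b n \<in> H" for k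
  proof -
    let ?H = "generate G (k ` {..<M})"
    have H: "subgroup ?H G" by (rule generate_is_subgroup) (use k in auto)
    have "b n \<in> ?H" if "n < M" for n
      by (rule bk[OF that H]) (auto intro: generate.incl)
    then have "generate G (b ` {..<M}) \<subseteq> ?H"
      by (intro generate_subgroup_incl[OF _ H]) auto
    with gen show ?thesis by blast
  qed
  have M: "M > 0" using q by simp
  have b_in: "b n \<in> H" if "subgroup H G" "u \<in> H" "g n \<in> H" for n H
    using subgroup_cancel_right[OF that(1) b[of n] subgroup_nat_pow_closed[OF that(1,2)]] that(3)
    by (auto simp: g_def split: if_splits)
  \<comment> \<open>All factors are killed by \<open>p ^ f\<close>, so a nontrivial
    \<open>N\<close>-th power already forces the product to have order \<open>p ^ f\<close>.\<close>
  have finish: thesis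
    if k: "\<And>n. n < M \<Longrightarrow> k n \<in> carrier G"
      and kgen: "carrier G \<subseteq> generate G (k ` {..<M})"
      and kord: "\<And>n. n \<in> {m..<M} \<Longrightarrow> ord (k n) = p ^ d n"
      and kN: "(\<Otimes>n\<in>{m..<M}. k n) [^] N \<noteq> \<one>" for k
  proof (rule result[of k])
    show "ord (\<Otimes>n\<in>{m..<M}. k n) = p ^ f"
    proof (rule ord_prime_powerI[OF p])
      have "k n [^] (p ^ f) = \<one>" if "n \<in> {m..<M}" for n
        using kord[OF that] d[OF that] k[of n] that by (auto simp: pow_eq_id dvd_iff)
      then show "(\<Otimes>n\<in>{m..<M}. k n) [^] (p ^ f) = \<one>"
        by (subst nat_pow_finprod) (use k in \<open>auto intro!: finprod_one_eqI\<close>)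
    qed (use k kN f in \<open>auto simp: N_def intro!: finprod_closed\<close>)
  qed (use k kgen kord in auto)
  show thesis
  proof (cases "S [^] N = \<one>")
    case False
    show thesis
    proof (rule finish[of g])
      show "carrier G \<subseteq> generate G (g ` {..<M})"
        by (rule generateI) (use g b_in g0 M in metis)+
    qed (use g g_ord False S_def in auto)
  next
    case True
    \<comment> \<open>It suffices to replace \<open>g n0\<close> by an element whose \<open>N\<close>-th power differs from that of \<open>g n0\<close>.\<close>
    define n0 where "n0 = m + q - 1"
    have n0: "n0 \<in> {m..<m + q}" "n0 \<in> {m..<M}" "n0 < M" using q by (auto simp: n0_def)
    have d0: "d n0 = f" by (rule d_top[OF n0(1)])
    define y where "y = g n0 [^] N"
    have y: "y \<in> carrier G" "y \<noteq> \<one>" using g g_top_neq[OF n0(1)] by (simp_all add: y_def)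
    have "\<exists>a \<in> carrier G. ord a = p ^ f \<and> a [^] N \<noteq> y \<and>
        carrier G \<subseteq> generate G ((g(n0 := a)) ` {..<M})"
    proof (cases "p = 2")
      case False
      let ?a = "inv (g n0)"
      \<comment> \<open>A nontrivial element killed by an odd prime is not its own inverse, so
        inverting \<open>g n0\<close> changes its \<open>N\<close>-th power.\<close>
      have "y [^] (2::nat) \<noteq> \<one>"
      proof
        assume "y [^] (2::nat) = \<one>"
        then have "ord y dvd 2" using y pow_eq_id by simp
        moreover have "y [^] p = \<one>"
        proof -
          have "y [^] p = g n0 [^] (p ^ (f - 1 + 1))"
            using pp[OF g, of n0 "f - 1" 1] by (simp add: y_def N_def)
          then show ?thesis using f g_ord[OF n0(2)] d0 g by (simp add: pow_eq_id)
        qed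
        then have "ord y dvd p" using y pow_eq_id by simp
        moreover have "coprime 2 p"
          using False p primes_coprime two_is_prime_nat by metis
        ultimately have "ord y = 1" by (metis coprime_def nat_dvd_1_iff_1)
        then show False using y ord_eq_1 by simp
      qed
      then have "?a [^] N \<noteq> y"
        using y g by (auto simp: y_def nat_pow_inv numeral_2_eq_2)
          (metis g nat_pow_closed l_inv)
      moreover have "carrier G \<subseteq> generate G ((g(n0 := ?a)) ` {..<M})"
      proof (rule generateI)
        fix n H assume *: "n < M" "subgroup H G" "\<And>i. i < M \<Longrightarrow> (g(n0 := ?a)) i \<in> H"
        have gH: "g i \<in> H" if "i < M" for i
        proof (cases "i = n0")
          case True
          then have "inv (inv (g i)) \<in> H" using *(3)[OF that] *(2) by (simp add: subgroup.m_inv_closed)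
          then show ?thesis using g by simp
        qed (use *(3)[OF that] in simp)
        show "b n \<in> H" using b_in[OF *(2) _ gH[OF *(1)]] gH[OF M] g0 by simp
      qed (use g in auto)
      ultimately show ?thesis using g g_ord[OF n0(2)] d0 by (intro bexI[of _ ?a]) auto
    next
      case p2: True
      \<comment> \<open>As the last top index, \<open>n0\<close> is 0 only if \<open>m = 0\<close>
        and \<open>q = 1\<close>; then \<open>S [^] N = z\<close>, against the case assumption.
        Hence \<open>u\<close> is not the element replaced.\<close>
      have n01: "n0 \<ge> 1"
      proof (rule ccontr)
        assume "\<not> n0 \<ge> 1"
        then have "m = 0" "q = 1" using q by (auto simp: n0_def)
        then have "S [^] N = z [^] (1::nat)" using S_pow by simp
        then show False using True z z1 by simp
      qed
      \<comment> \<open>Otherwise every top index other than 0 is corrected by \<open>u\<close>, so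
        \<open>S [^] N = z [^] q\<close>, which is nontrivial because \<open>q\<close> is odd and
        \<open>z\<close> has order 2.\<close>
      have s1f: "s 1 \<ge> f"
      proof (rule ccontr)
        assume *: "\<not> s 1 \<ge> f"
        have "S [^] N = z [^] q"
          by (rule S_pow) (use s1 * in \<open>metis One_nat_def Suc_leI le_trans linorder_not_less not_gr0\<close>)
        then have "z [^] q = \<one>" using True by simp
        then show False using z_pow two * p2 by simp
      qed
      have zz: "z \<otimes> z = \<one>" using zp z p2 by (simp add: numeral_2_eq_2)
      show ?thesis
      proof (cases "s n0 = f")
        case sf: True
        \<comment> \<open>The extra factor changes the \<open>N\<close>-th power from
          \<open>y\<close> to \<open>y \<otimes> z\<close>. Independence gives
          \<open>y \<noteq> z\<close>, and \<open>z\<close> is an involution, so this power is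
          nontrivial and the order stays \<open>p ^ f\<close>.\<close>
        let ?a = "b n0 \<otimes> u [^] (p ^ (e - f))"
        have gb: "g n0 = b n0" using sf d0 by (simp add: g_def)
        have aN: "?a [^] N = y \<otimes> z"
          using b u f by (simp add: nat_pow_distrib pp y_def gb N_def z_def)
        have "y \<noteq> z" using indep[OF n01] sf f by (simp add: y_def gb N_def z_def u_def)
        then have yz: "y \<otimes> z \<noteq> \<one>" using zz y z by (metis right_cancel)
        have "ord ?a = p ^ f"
        proof (rule ord_prime_powerI[OF p])
          have "?a [^] (p ^ f) = b n0 [^] (p ^ f) \<otimes> u [^] (p ^ e)"
            using b u f by (simp add: nat_pow_distrib pp)
          then show "?a [^] (p ^ f) = \<one>" using ue b_pow[of n0 f] sf by simp
        qed (use b u f aN yz in \<open>auto simp: N_def\<close>)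
        moreover have "?a [^] N \<noteq> y" using aN y z z1 by simp
        moreover have "carrier G \<subseteq> generate G ((g(n0 := ?a)) ` {..<M})"
        proof (rule generateI)
          fix n H assume *: "n < M" "subgroup H G" "\<And>i. i < M \<Longrightarrow> (g(n0 := ?a)) i \<in> H"
          have uH: "u \<in> H" using *(3)[OF M] n01 g0 by simp
          have "b n0 \<in> H"
            using subgroup_cancel_right[OF *(2) b[of n0] subgroup_nat_pow_closed[OF *(2) uH]]
              *(3)[OF n0(3)] by auto
          then show "b n \<in> H"
            using b_in[OF *(2) uH, of n] *(3)[OF *(1)] by (cases "n = n0") auto
        qed (use g b u in auto)
        ultimately show ?thesis using b u by (intro bexI[of _ ?a]) auto
      next
        case False
        then have sf: "s n0 < f" using sd[OF n0(2)] d0 by simp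
        then have n02: "n0 \<noteq> 1" using s1f by auto
        \<comment> \<open>Here \<open>g n0\<close> was corrected by \<open>u\<close>, so
          \<open>y = z\<close>. Correcting by \<open>b 1\<close> instead gives the
          \<open>N\<close>-th power \<open>b 1 [^] (p ^ (s 1 - 1))\<close>, which differs from
          \<open>z\<close> by independence. As \<open>n0 \<noteq> 1\<close>, \<open>b 1\<close> can
          still be recovered.\<close>
        let ?a = "b n0 \<otimes> b 1 [^] (p ^ (s 1 - f))"
        have b1: "b 1 [^] (p ^ s 1) = \<one>" "b 1 [^] (p ^ (s 1 - 1)) \<noteq> \<one>"
          using b_pow[of 1] s1f f by auto
        have "y = z" using g_top[OF n0(1) sf] by (simp add: y_def)
        then have "?a [^] N \<noteq> y"
          using modify_pow[OF sf s1f b b1] indep[of 1] s1f f by (simp add: N_def z_def u_def)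
        moreover have "carrier G \<subseteq> generate G ((g(n0 := ?a)) ` {..<M})"
        proof (rule generateI)
          fix n H assume *: "n < M" "subgroup H G" "\<And>i. i < M \<Longrightarrow> (g(n0 := ?a)) i \<in> H"
          have uH: "u \<in> H" using *(3)[OF M] n01 g0 by simp
          have "1 < M" using n0 n01 by simp
          then have bH: "b 1 \<in> H" using b_in[OF *(2) uH, of 1] *(3)[of 1] n02 by simp
          have "b n0 \<in> H"
            using subgroup_cancel_right[OF *(2) b[of n0] subgroup_nat_pow_closed[OF *(2) bH]]
              *(3)[OF n0(3)] by auto
          then show "b n \<in> H"
            using b_in[OF *(2) uH, of n] *(3)[OF *(1)] by (cases "n = n0") auto
        qed (use g b u in auto)
        ultimately show ?thesis using b modify_ord[OF sf s1f b b1] by (intro bexI[of _ ?a]) auto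
      qed
    qed
    then obtain a where a: "a \<in> carrier G" "ord a = p ^ f" "a [^] N \<noteq> y"
      "carrier G \<subseteq> generate G ((g(n0 := a)) ` {..<M})" by blast
    let ?P = "\<Otimes>n\<in>{m..<M} - {n0}. g n"
    have P: "?P \<in> carrier G" by (rule finprod_closed) (use g in auto)
    have split: "{m..<M} = insert n0 ({m..<M} - {n0})" using n0 by auto
    have "S = g n0 \<otimes> ?P"
      unfolding S_def by (subst split, rule finprod_insert) (use g in auto)
    \<comment> \<open>The other factors have \<open>N\<close>-th power inverse to \<open>y\<close>,
      so a factor \<open>a\<close> with a different \<open>N\<close>-th power cannot cancel
      them.\<close>
    then have "y \<otimes> ?P [^] N = \<one>" using True P g by (simp add: nat_pow_distrib y_def)
    moreover have "(\<Otimes>n\<in>{m..<M}. (g(n0 := a)) n) = a \<otimes> ?P"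
    proof -
      have "(\<Otimes>n\<in>{m..<M}. (g(n0 := a)) n)
          = (g(n0 := a)) n0 \<otimes> (\<Otimes>n\<in>{m..<M} - {n0}. (g(n0 := a)) n)"
        by (subst split, rule finprod_insert) (use g a in auto)
      also have "(\<Otimes>n\<in>{m..<M} - {n0}. (g(n0 := a)) n) = ?P"
        by (rule finprod_cong') (use g in auto)
      finally show ?thesis by simp
    qed
    ultimately have "(\<Otimes>n\<in>{m..<M}. (g(n0 := a)) n) [^] N \<noteq> \<one>"
      using a y P by (metis nat_pow_closed nat_pow_distrib right_cancel)
    then show thesis
      by (intro finish[of "g(n0 := a)"]) (use a g g_ord d0 in auto)
  qed
qed

end

subsection \<open>Bases of finite abelian \<open>p\<close>-groups\<close>

text \<open>The basis consists of the unit vectors; \<open>n l \<ge> 2\<close> makes 1 a reduced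
  residue in each coordinate. Powers of two different unit vectors have disjoint supports, hence
  agree only if trivial.\<close>

lemma sum_group_cyclic_basis:
  fixes n :: "'i \<Rightarrow> nat"
  assumes I: "finite I" and n: "\<And>l. l \<in> I \<Longrightarrow> n l \<ge> 2"
  defines "K \<equiv> sum_group I (\<lambda>l. integer_mod_group (n l))"
  obtains b where "comm_group K" and "b \<in> I \<rightarrow> carrier K"
    and "\<And>l. l \<in> I \<Longrightarrow> group.ord K (b l) = n l"
    and "carrier K \<subseteq> generate K (b ` I)"
    and "\<And>l l' i j. l \<in> I \<Longrightarrow> l' \<in> I \<Longrightarrow> l \<noteq> l' \<Longrightarrow>
      b l [^]\<^bsub>K\<^esub> (i::nat) = b l' [^]\<^bsub>K\<^esub> (j::nat) \<Longrightarrow> b l [^]\<^bsub>K\<^esub> i = \<one>\<^bsub>K\<^esub>"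
proof
  define b where "b l = (\<lambda>i\<in>I. if i = l then 1 else 0 :: int)" for l
  have grp: "group K" by (simp add: K_def)
  interpret K: group K by (fact grp)
  have carr: "carrier K = (\<Pi>\<^sub>E l\<in>I. {0..<int (n l)})"
  proof -
    have "carrier (integer_mod_group (n l)) = {0..<int (n l)}" if "l \<in> I" for l
      using n[OF that] by (simp add: carrier_integer_mod_group)
    then show ?thesis
      unfolding K_def by (subst carrier_sum_group) (use I in \<open>auto cong: PiE_cong\<close>)
  qed
  have mult: "x \<otimes>\<^bsub>K\<^esub> y = (\<lambda>l\<in>I. (x l + y l) mod int (n l))" for x y
    by (simp add: K_def)
  have one: "\<one>\<^bsub>K\<^esub> = (\<lambda>l\<in>I. 0)" by (simp add: K_def)
  show "comm_group K"
    by (rule K.group_comm_groupI) (simp add: mult add.commute)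
  have bc: "b l \<in> carrier K" if "l \<in> I" for l
    using that n by (force simp: carr b_def PiE_iff)
  then show "b \<in> I \<rightarrow> carrier K" by blast
  have pow: "b l [^]\<^bsub>K\<^esub> k = (\<lambda>i\<in>I. if i = l then int k mod int (n l) else 0)" for l and k :: nat
    by (induction k) (auto simp: one mult b_def fun_eq_iff mod_simps add.commute)
  have pow_one: "b l [^]\<^bsub>K\<^esub> k = \<one>\<^bsub>K\<^esub> \<longleftrightarrow> n l dvd k" if "l \<in> I" for l and k :: nat
  proof -
    have "b l [^]\<^bsub>K\<^esub> k = \<one>\<^bsub>K\<^esub> \<longleftrightarrow> int k mod int (n l) = 0"
      using that by (auto simp: pow one fun_eq_iff)
    then show ?thesis by (metis dvd_eq_mod_eq_0 int_dvd_int_iff)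
  qed
  then show "K.ord (b l) = n l" if "l \<in> I" for l
    using that bc by (simp add: K.ord_unique)
  show "b l [^]\<^bsub>K\<^esub> i = \<one>\<^bsub>K\<^esub>"
    if "l \<in> I" "l' \<in> I" "l \<noteq> l'" "b l [^]\<^bsub>K\<^esub> i = b l' [^]\<^bsub>K\<^esub> j" for l l' and i j :: nat
  proof -
    have "(b l [^]\<^bsub>K\<^esub> i) l = (b l' [^]\<^bsub>K\<^esub> j) l" using that by simp
    then show ?thesis using that(1,3) by (auto simp: pow one fun_eq_iff)
  qed
  show "carrier K \<subseteq> generate K (b ` I)"
  proof
    fix x assume x: "x \<in> carrier K"
    let ?H = "generate K (b ` I)"
    have "subgroup ?H K" by (rule K.generate_is_subgroup) (use bc in auto)
    \<comment> \<open>The vector is assembled one coordinate at a time, by induction on the set of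
      coordinates already filled.\<close>
    have "(\<lambda>l\<in>I. if l \<in> S then x l else 0) \<in> ?H" if "S \<subseteq> I" for S
      using finite_subset[OF that I] that
    proof (induction S)
      case empty
      have "(\<lambda>l\<in>I. if l \<in> {} then x l else 0) = \<one>\<^bsub>K\<^esub>"
        by (simp add: one fun_eq_iff)
      then show ?case using generate.one[of K "b ` I"] by (simp only:)
    next
      case (insert l S)
      then have xl: "0 \<le> x l" "x l < int (n l)" using x by (auto simp: carr)
      have "b l [^]\<^bsub>K\<^esub> k \<in> ?H" for k :: nat
        by (induction k) (use insert in \<open>auto intro: generate.one generate.eng generate.incl\<close>)
      moreover have "(\<lambda>i\<in>I. if i \<in> insert l S then x i else 0)
          = (\<lambda>i\<in>I. if i \<in> S then x i else 0) \<otimes>\<^bsub>K\<^esub> b l [^]\<^bsub>K\<^esub> nat (x l)"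
        using insert.hyps insert.prems xl x by (auto simp: mult pow fun_eq_iff carr PiE_iff)
      moreover have "(\<lambda>i\<in>I. if i \<in> S then x i else 0) \<in> ?H"
        using insert.IH insert.prems by blast
      ultimately show ?case by (simp only: generate.eng)
    qed
    from this[OF subset_refl] have "(\<lambda>l\<in>I. x l) \<in> ?H"
      by (simp cong: restrict_cong)
    then show "x \<in> ?H" using x by (simp add: carr PiE_restrict)
  qed
qed

text \<open>The unit vectors are transported along an isomorphism; injectivity preserves which
  powers are trivial, hence orders and independence.\<close>

lemma abelian_p_group_basis:
  fixes G :: "('a, 'b) monoid_scheme"
  assumes p: "prime p" and G: "group G" "G \<cong> abelian_p_group p e r"
  defines "I \<equiv> SIGMA i:{1..e}. {1..r i}"
  obtains b where "comm_group G" and "b \<in> I \<rightarrow> carrier G"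
    and "\<And>l. l \<in> I \<Longrightarrow> group.ord G (b l) = p ^ fst l"
    and "carrier G \<subseteq> generate G (b ` I)"
    and "\<And>l l' i j. l \<in> I \<Longrightarrow> l' \<in> I \<Longrightarrow> l \<noteq> l' \<Longrightarrow>
      b l [^]\<^bsub>G\<^esub> (i::nat) = b l' [^]\<^bsub>G\<^esub> (j::nat) \<Longrightarrow> b l [^]\<^bsub>G\<^esub> i = \<one>\<^bsub>G\<^esub>"
proof -
  let ?K = "abelian_p_group p e r"
  have K: "?K = sum_group I (\<lambda>l. integer_mod_group (p ^ fst l))"
    by (simp add: abelian_p_group_def I_def case_prod_unfold)
  have 2: "p ^ fst l \<ge> 2" if "l \<in> I" for l
  proof -
    have "p ^ 1 \<le> p ^ fst l"
      using that prime_gt_0_nat[OF p] by (intro power_increasing) (auto simp: I_def)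
    then show ?thesis using prime_ge_2_nat[OF p] by simp
  qed
  have "finite I" by (simp add: I_def)
  then obtain b where comm: "comm_group ?K" and b: "b \<in> I \<rightarrow> carrier ?K"
    and b_ord: "\<And>l. l \<in> I \<Longrightarrow> group.ord ?K (b l) = p ^ fst l"
    and gen: "carrier ?K \<subseteq> generate ?K (b ` I)"
    and indep: "\<And>l l' i j. l \<in> I \<Longrightarrow> l' \<in> I \<Longrightarrow> l \<noteq> l' \<Longrightarrow>
      b l [^]\<^bsub>?K\<^esub> (i::nat) = b l' [^]\<^bsub>?K\<^esub> (j::nat) \<Longrightarrow> b l [^]\<^bsub>?K\<^esub> i = \<one>\<^bsub>?K\<^esub>"
    unfolding K using sum_group_cyclic_basis[of I "\<lambda>l. p ^ fst l"] 2 by metis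
  have grpK: "group ?K" using comm by (simp add: comm_group_def)
  obtain \<psi> where \<psi>: "\<psi> \<in> iso ?K G"
    using group.iso_sym[OF G] by (auto simp: is_iso_def)
  interpret \<psi>: group_hom ?K G \<psi>
    using \<psi> G grpK by (simp add: group_hom_def group_hom_axioms_def iso_def)
  have inj: "inj_on \<psi> (carrier ?K)" and surj: "\<psi> ` carrier ?K = carrier G"
    using \<psi> by (auto simp: iso_def bij_betw_def)
  have pow: "\<psi> (b l) [^]\<^bsub>G\<^esub> k = \<psi> (b l [^]\<^bsub>?K\<^esub> k)" if "l \<in> I" for l and k :: nat
    using \<psi>.hom_nat_pow[OF funcset_mem[OF b that]] by simp
  have pow_one: "\<psi> (b l) [^]\<^bsub>G\<^esub> k = \<one>\<^bsub>G\<^esub> \<longleftrightarrow> b l [^]\<^bsub>?K\<^esub> k = \<one>\<^bsub>?K\<^esub>" if "l \<in> I" for l and k :: nat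
    using that b inj_onD[OF inj, of "b l [^]\<^bsub>?K\<^esub> k" "\<one>\<^bsub>?K\<^esub>"] by (auto simp: pow)
  show thesis
  proof (rule that[of "\<psi> \<circ> b"])
    show "comm_group G"
      using comm_group.iso_imp_comm_group[OF comm] \<psi> G(1)
      by (auto simp: is_iso_def group.is_monoid)
    show "\<psi> \<circ> b \<in> I \<rightarrow> carrier G" using b by (auto simp: Pi_iff)
    show "group.ord G ((\<psi> \<circ> b) l) = p ^ fst l" if "l \<in> I" for l
    proof -
      have "b l \<in> carrier ?K" using b that by auto
      then show ?thesis
        using that b_ord[OF that] \<psi>.G.pow_eq_id[of "b l"] by (simp add: \<psi>.H.ord_unique pow_one)
    qed
    have "b ` I \<subseteq> carrier ?K" using b by auto
    from \<psi>.generate_img[OF this] show "carrier G \<subseteq> generate G ((\<psi> \<circ> b) ` I)"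
      using image_mono[OF gen, of \<psi>] surj by (simp add: image_comp)
    show "(\<psi> \<circ> b) l [^]\<^bsub>G\<^esub> i = \<one>\<^bsub>G\<^esub>"
      if "l \<in> I" "l' \<in> I" "l \<noteq> l'" "(\<psi> \<circ> b) l [^]\<^bsub>G\<^esub> i = (\<psi> \<circ> b) l' [^]\<^bsub>G\<^esub> j" for l l' and i j :: nat
    proof -
      have "\<psi> (b l [^]\<^bsub>?K\<^esub> i) = \<psi> (b l' [^]\<^bsub>?K\<^esub> j)" using that by (simp add: pow)
      moreover have "b l [^]\<^bsub>?K\<^esub> i \<in> carrier ?K" "b l' [^]\<^bsub>?K\<^esub> j \<in> carrier ?K"
        using that b by auto
      ultimately have "b l [^]\<^bsub>?K\<^esub> i = b l' [^]\<^bsub>?K\<^esub> j" by (metis inj inj_onD)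
      then show ?thesis using indep that pow_one by simp
    qed
  qed
qed

subsection \<open>Matching basis elements with generators\<close>

text \<open>Even positions will serve as images of the \<open>Gen_a k\<close>, odd ones as images of
  the \<open>Gen_b k\<close>.\<close>

lemma image_lessThan_double:
  fixes h :: nat
  shows
  "g ` {..<2 * h} = (\<lambda>k. g (2 * (k - 1))) ` {1..h} \<union> (\<lambda>k. g (2 * (k - 1) + 1)) ` {1..h}"
  (is "_ = ?E \<union> ?O")
proof
  show "g ` {..<2 * h} \<subseteq> ?E \<union> ?O"
  proof
    fix y assume "y \<in> g ` {..<2 * h}"
    then obtain n where n: "n < 2 * h" "y = g n" by auto
    define k where "k = n div 2 + 1"
    have "k \<in> {1..h}" "n = 2 * (k - 1) \<or> n = 2 * (k - 1) + 1"
      using n(1) unfolding k_def by auto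
    then show "y \<in> ?E \<union> ?O" using n(2) by blast
  qed
qed force

section \<open>Positions in decreasing order and tail sums\<close>

lemma length_index_pairs: "length (index_pairs n y) = (\<Sum>i=1..n. y i)"
  by (induction n) (auto simp: index_pairs_Suc)

text \<open>Tail sums count the pairs with first entry at least \<open>i\<close>; this turns the
  counting hypotheses into comparisons of positions.\<close>

lemma fst_rev_index_pairs_ge_iff:
  assumes "i \<ge> 1" "n < length (index_pairs k y)"
  shows "fst (rev (index_pairs k y) ! n) \<ge> i \<longleftrightarrow> n < (\<Sum>j=i..k. y j)"
  using rev_sorted_nth_ge_iff[OF sorted_index_pairs assms(2)] assms(1)
  by (simp add: length_filter_index_pairs)

text \<open>Tail sums decrease as their lower limit grows, so every index with tail sum at least 2
  lies below \<open>f\<close>.\<close>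

lemma prime_index_less:
  assumes "(\<Sum>j=f..e. r j) \<le> 1" "f \<ge> 1"
  shows "prime_index e r < f"
proof (cases "(\<Sum>j=1..e. r j) \<le> 1")
  case True
  then show ?thesis using assms by (simp add: prime_index_def)
next
  case False
  let ?D = "{d \<in> {1..e}. (\<Sum>j=d..e. r j) \<ge> 2}"
  have "d < f" if "d \<in> ?D" for d
  proof (rule ccontr)
    assume "\<not> d < f"
    then have "(\<Sum>j=d..e. r j) \<le> (\<Sum>j=f..e. r j)" by (intro sum_mono2) auto
    then show False using that assms by simp
  qed
  moreover have "1 \<in> ?D" using False by (cases "e = 0") auto
  ultimately have "Max ?D < f" by (subst Max_less_iff) auto
  then show ?thesis using False by (simp add: prime_index_def)
qed

text \<open>The tail sum from \<open>f\<close> is \<open>x f\<close> alone. The bound 2 leaves a top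
  generator after one has been set aside.\<close>

lemma prime_index_self:
  assumes "prime_index f x = f" "f \<ge> 1"
  shows "x f \<ge> 2"
proof (rule ccontr)
  assume "\<not> x f \<ge> 2"
  then have "prime_index f x < f" using assms by (intro prime_index_less) auto
  then show False using assms by simp
qed

lemma (in comm_group) smooth_epi_exists_if_basis:
  fixes p e f h :: nat and r x :: "nat \<Rightarrow> nat"
  defines "I \<equiv> SIGMA i:{1..e}. {1..r i}"
  assumes p: "prime p" and e: "e \<ge> 1" "r e \<ge> 1"
    and b0: "b0 \<in> I \<rightarrow> carrier G"
    and b0_ord: "\<And>l. l \<in> I \<Longrightarrow> ord (b0 l) = p ^ fst l"
    and b0_gen: "carrier G \<subseteq> generate G (b0 ` I)"
    and indep: "\<And>l l' i j. l \<in> I \<Longrightarrow> l' \<in> I \<Longrightarrow> l \<noteq> l' \<Longrightarrow>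
      b0 l [^] (i::nat) = b0 l' [^] (j::nat) \<Longrightarrow> b0 l [^] i = \<one>"
    and f': "prime_index f x = f" and fe: "f \<le> e"
    and two: "p = 2 \<Longrightarrow> prime_index e r < f \<Longrightarrow> even (x f)"
    and count: "\<And>i. 1 \<le> i \<Longrightarrow> i \<le> f \<Longrightarrow> 2 * h + (\<Sum>j=i..f. x j) \<ge> 1 + (\<Sum>j=i..e. r j)"
    and count_high: "2 * h \<ge> (\<Sum>j=f+1..e. r j)"
  shows "\<exists>\<phi>. smooth_epi p f x h G \<phi>"
proof -
  let ?J = "SIGMA i:{1..f}. {1..x i}"
  define bs where "bs = rev (index_pairs e r)"
  have bs_len: "length bs = (\<Sum>j=1..e. r j)" by (simp add: bs_def length_index_pairs)
  have bs_set: "set bs = I" by (simp add: I_def bs_def set_index_pairs)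
  define b where "b n = (if n < length bs then b0 (bs ! n) else \<one>)" for n
  \<comment> \<open>The padding gets exponent 0, in accordance with
    \<open>ord \<one> = p ^ 0\<close>.\<close>
  define s where "s n = (if n < length bs then fst (bs ! n) else 0)" for n
  have nth_I: "bs ! n \<in> I" if "n < length bs" for n using nth_mem[OF that] bs_set by simp
  have b: "b n \<in> carrier G" for n
    using b0 nth_I[of n] by (auto simp: b_def)
  have b_ord: "ord (b n) = p ^ s n" for n
    using b0_ord[OF nth_I, of n] by (simp add: b_def s_def)
  have s_ge: "s n \<ge> i \<longleftrightarrow> n < (\<Sum>j=i..e. r j)" if "i \<ge> 1" for n i
  proof (cases "n < length bs")
    case True
    then show ?thesis
      using fst_rev_index_pairs_ge_iff[OF that, of n e r] by (simp add: s_def bs_def)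
  next
    case False
    have "(\<Sum>j=i..e. r j) \<le> (\<Sum>j=1..e. r j)" using that by (intro sum_mono2) auto
    then show ?thesis using False that by (simp add: s_def bs_len)
  qed
  have b_gen: "carrier G \<subseteq> generate G (b ` {..<M})" if "length bs \<le> M" for M
  proof -
    have "b0 ` I \<subseteq> b ` {..<M}"
      using that unfolding bs_set[symmetric]
      by (force simp: b_def in_set_conv_nth image_iff)
    then show ?thesis using mono_generate b0_gen by blast
  qed
  show ?thesis
  proof (cases "f \<ge> 1")
    case False
    \<comment> \<open>With no \<open>Gen_c\<close> present, \<open>count_high\<close> says that the
      free generators accommodate the whole basis.\<close>
    then have "f = 0" by simp
    then have "length bs \<le> 2 * h" using count_high by (simp add: bs_len)
    then have "carrier G \<subseteq> generate G ((\<lambda>k. b (2 * (k - 1))) ` {1..h} \<union>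
        (\<lambda>k. b (2 * (k - 1) + 1)) ` {1..h} \<union> (\<lambda>_. \<one>) ` ?J)"
      using False b_gen[of "2 * h"] unfolding image_lessThan_double by simp
    then show ?thesis
      by (rule smooth_epi_exists[OF p, rotated -1]) (use False b in auto)
  next
    case f: True
    define cs where "cs = rev (index_pairs f x)"
    define L where "L = length cs"
    have cs_len: "L = (\<Sum>j=1..f. x j)" by (simp add: L_def cs_def length_index_pairs)
    have cs_set: "set cs = ?J" by (simp add: cs_def set_index_pairs)
    have nth_J: "cs ! n \<in> ?J" if "n < L" for n using nth_mem[of n cs] that cs_set by (simp add: L_def)
    have t_ge: "fst (cs ! n) \<ge> i \<longleftrightarrow> n < (\<Sum>j=i..f. x j)" if "i \<ge> 1" "n < L" for n i
      using fst_rev_index_pairs_ge_iff[OF that(1), of n f x] that(2) by (simp add: cs_def L_def)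
    have xf: "x f \<ge> 2" by (rule prime_index_self[OF f' f])
    have "x f \<le> L" unfolding cs_len by (rule member_le_sum) (use f in auto)
    then have L: "x f \<le> L" "L \<ge> 2" using xf by auto
    define m where "m = 2 * h"
    \<comment> \<open>The subtracted 1 accounts for the generator set aside, entry 0 of
      \<open>cs\<close>. The shift in \<open>d\<close> skips the same entry, leaving
      \<open>x f - 1\<close> top indices.\<close>
    define M where "M = m + L - 1"
    define d where "d n = fst (cs ! (n - m + 1))" for n
    have d_in: "1 \<le> d n \<and> d n \<le> f" if "n \<in> {m..<M}" for n
    proof -
      have "n - m + 1 < L" using that by (auto simp: M_def)
      from nth_J[OF this] show ?thesis by (auto simp: d_def mem_Times_iff)
    qed
    have d_ge: "d n \<ge> i \<longleftrightarrow> n - m + 1 < (\<Sum>j=i..f. x j)" if "n \<in> {m..<M}" "i \<ge> 1" for n i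
      using t_ge[OF that(2), of "n - m + 1"] that(1) by (auto simp: d_def M_def)
    obtain g where g: "\<And>n. n < M \<Longrightarrow> g n \<in> carrier G"
      and g_gen: "carrier G \<subseteq> generate G (g ` {..<M})"
      and g_ord: "\<And>n. n \<in> {m..<M} \<Longrightarrow> ord (g n) = p ^ d n"
      and g_prod: "ord (\<Otimes>n\<in>{m..<M}. g n) = p ^ f"
    proof (rule generators_of_prescribed_orders[where m = m and q = "x f - 1" and d = d and s = s])
      note result = that
      show thesis
        if "\<And>n. n < M \<Longrightarrow> k n \<in> carrier G" "carrier G \<subseteq> generate G (k ` {..<M})"
          "\<And>n. n \<in> {m..<M} \<Longrightarrow> ord (k n) = p ^ d n" "ord (\<Otimes>n\<in>{m..<M}. k n) = p ^ f" for k
        using that by (rule result)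
      show "carrier G \<subseteq> generate G (b ` {..<M})"
        using count[of 1] f by (intro b_gen) (simp add: bs_len M_def m_def cs_len)
      have "\<not> s 0 \<ge> e + 1" using s_ge[of "e + 1" 0] by simp
      moreover have "s 0 \<ge> e" using s_ge[of e 0] e by simp
      ultimately show "s 0 = e" by simp
      show "s n \<le> s 1" if "n \<ge> 1" for n
        using s_ge[of "s n" n] s_ge[of "s n" 1] that by (cases "s n = 0") auto
      show "d n = f" if "n \<in> {m..<m + (x f - 1)}" for n
      proof -
        have "n \<in> {m..<M}" using that L unfolding M_def atLeastLessThan_iff by linarith
        then have "d n \<ge> f" "d n \<le> f" using d_ge[of n f] d_in[of n] that f by auto
        then show ?thesis by simp
      qed
      show "1 \<le> d n \<and> d n < f" if "n \<in> {m + (x f - 1)..<M}" for n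
      proof -
        have "n \<in> {m..<M}" using that by simp
        moreover have "\<not> n - m + 1 < x f" using that by auto
        ultimately show ?thesis using d_ge[of n f] d_in[of n] f by auto
      qed
      \<comment> \<open>By \<open>count_high\<close>, exponents above \<open>f\<close> occur only at
        free positions. Otherwise \<open>count\<close> at \<open>s n\<close> puts position
        \<open>n\<close> within the generators of exponent at least \<open>s n\<close>; its summand
        1 pays for the one set aside.\<close>
      show "s n \<le> d n" if n: "n \<in> {m..<M}" for n
      proof (cases "s n = 0")
        case False
        then have 1: "n < (\<Sum>j=s n..e. r j)" using s_ge[of "s n" n] by simp
        have "s n \<le> f"
        proof (rule ccontr)
          assume "\<not> s n \<le> f"
          then have "(\<Sum>j=s n..e. r j) \<le> (\<Sum>j=f+1..e. r j)" by (intro sum_mono2) auto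
          then show False using 1 n count_high by (simp add: m_def)
        qed
        then have "1 + (\<Sum>j=s n..e. r j) \<le> m + (\<Sum>j=s n..f. x j)"
          using count[of "s n"] False by (simp add: m_def)
        then have "n - m + 1 < (\<Sum>j=s n..f. x j)"
          using 1 n unfolding atLeastLessThan_iff by linarith
        then show ?thesis using d_ge[OF n, of "s n"] False by simp
      qed simp
      \<comment> \<open>\<open>s 1 < f\<close> says that at most one basis element has order
        \<open>p ^ f\<close> or more, so \<open>prime_index e r < f\<close> and the parity
        hypothesis applies.\<close>
      show "odd (x f - 1)" if "p = 2" "s 1 < f"
      proof -
        have "(\<Sum>j=f..e. r j) \<le> 1" using s_ge[of f 1] that f by simp
        then have "even (x f)" using two[OF that(1) prime_index_less] f by simp
        then show ?thesis using xf by simp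
      qed
      show "b n [^] p ^ (s n - 1) \<noteq> b 0 [^] p ^ (e - 1)" if n: "n \<ge> 1" "s n \<ge> 1" for n
      proof
        assume eq: "b n [^] p ^ (s n - 1) = b 0 [^] p ^ (e - 1)"
        have len: "n < length bs" using n by (simp add: s_def split: if_splits)
        have "distinct bs" by (simp add: bs_def distinct_index_pairs)
        then have neq: "bs ! n \<noteq> bs ! 0" using len n by (subst nth_eq_iff_index_eq) auto
        have len0: "0 < length bs" using len by linarith
        have "b n [^] p ^ (s n - 1) = \<one>"
          using indep[OF nth_I[OF len] nth_I[OF len0] neq, of "p ^ (s n - 1)" "p ^ (e - 1)"]
            eq len len0 by (simp add: b_def)
        then have "p ^ s n dvd p ^ (s n - 1)" using pow_eq_id[OF b] by (simp add: b_ord)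
        then have "s n \<le> s n - 1"
          by (rule power_dvd_imp_le) (rule prime_gt_1_nat[OF p])
        then show False using n by simp
      qed
      show "1 \<le> x f - 1" "m + (x f - 1) \<le> M" using xf L by (simp_all add: M_def)
      show "prime p" "f \<le> e" "f \<ge> 1" by fact+
      show "b n \<in> carrier G" "ord (b n) = p ^ s n" for n by (fact b b_ord)+
    qed
    define D where "D = (\<Otimes>n\<in>{m..<M}. g n)"
    have D: "D \<in> carrier G" unfolding D_def by (rule finprod_closed) (use g in auto)
    \<comment> \<open>The first entry \<open>(f, x f)\<close> of \<open>cs\<close> is the generator set aside.\<close>
    define C where "C l = (let n = inv_into {..<L} ((!) cs) l in
      if n = 0 then inv D else g (m + n - 1))" for l
    have inj: "inj_on ((!) cs) {..<L}"
      by (rule inj_on_nth) (auto simp: cs_def distinct_index_pairs L_def)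
    have C: "C (cs ! n) = (if n = 0 then inv D else g (m + n - 1))" if "n < L" for n
      using inv_into_f_f[OF inj, of n] that by (simp add: C_def)
    have J: "?J = (!) cs ` {..<L}"
      unfolding cs_set[symmetric] L_def
      by (simp add: set_conv_nth lessThan_def image_Collect)
    have shift: "m + n - 1 \<in> {m..<M}" "m + n - 1 < M" if "n < L" "n \<noteq> 0" for n
      using that unfolding M_def atLeastLessThan_iff by linarith+
    have C_closed: "C (cs ! n) \<in> carrier G" if "n < L" for n
      using C[OF that] D g shift(2)[OF that] by (cases "n = 0") simp_all
    show ?thesis
    proof (rule smooth_epi_exists[OF p, where A = "\<lambda>k. g (2 * (k - 1))"
          and B = "\<lambda>k. g (2 * (k - 1) + 1)" and C = C])
      show "(\<lambda>k. g (2 * (k - 1))) \<in> {1..h} \<rightarrow> carrier G"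
        and "(\<lambda>k. g (2 * (k - 1) + 1)) \<in> {1..h} \<rightarrow> carrier G"
        using L by (auto intro!: g simp only: M_def m_def Pi_iff atLeastAtMost_iff)
      show "C \<in> ?J \<rightarrow> carrier G" unfolding J using C_closed by auto
      show "ord (C (i, j)) = p ^ i" if "i \<in> {1..f}" "j \<in> {1..x i}" for i j
      proof -
        have "(i, j) \<in> (!) cs ` {..<L}" using that unfolding J[symmetric] by auto
        then obtain n where n: "n < L" "cs ! n = (i, j)" by auto
        show ?thesis
        proof (cases "n = 0")
          case True
          have "fst (cs ! 0) \<ge> f" using t_ge[of f 0] f L xf by simp
          then have "i = f" using n that True by simp
          then show ?thesis using C[OF n(1)] n True D g_prod by (simp add: D_def)
        next
          case False
          then have "d (m + n - 1) = i" using n by (simp add: d_def)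
          then show ?thesis
            using C[OF n(1)] n(2) False g_ord[OF shift(1)[OF n(1) False]] by simp
        qed
      qed
      have img: "{m..<M} = (\<lambda>n. m + n - 1) ` {1..<L}"
      proof
        show "{m..<M} \<subseteq> (\<lambda>n. m + n - 1) ` {1..<L}"
        proof
          fix n assume "n \<in> {m..<M}"
          then have "n = m + (n - m + 1) - 1" "n - m + 1 \<in> {1..<L}" by (auto simp: M_def)
          then show "n \<in> (\<lambda>n. m + n - 1) ` {1..<L}" by (rule image_eqI)
        qed
        show "(\<lambda>n. m + n - 1) ` {1..<L} \<subseteq> {m..<M}" using shift(1) by fastforce
      qed
      have "(\<Otimes>l\<in>?J. C l) = (\<Otimes>n\<in>{..<L}. C (cs ! n))"
        unfolding J by (rule finprod_reindex) (use inj C_closed in auto)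
      also have "{..<L} = insert 0 {1..<L}" using L by auto
      also have "(\<Otimes>n\<in>insert 0 {1..<L}. C (cs ! n)) = C (cs ! 0) \<otimes> (\<Otimes>n\<in>{1..<L}. C (cs ! n))"
        by (rule finprod_insert) (use C_closed L in auto)
      also have "(\<Otimes>n\<in>{1..<L}. C (cs ! n)) = (\<Otimes>n\<in>{1..<L}. g (m + n - 1))"
        by (rule finprod_cong') (use C g[OF shift(2)] in auto)
      also have "\<dots> = D"
        unfolding D_def img by (rule finprod_reindex[symmetric]) (use g[OF shift(2)] in \<open>auto simp: inj_on_def\<close>)
      also have "C (cs ! 0) \<otimes> D = \<one>" using C[of 0] L D by simp
      finally show "(\<Otimes>l\<in>?J. C l) = \<one>" .
      \<comment> \<open>Generation carries over from \<open>g\<close>: positions below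
        \<open>m\<close> go to the free generators, and all others are values of
        \<open>C\<close>.\<close>
      have "g n \<in> C ` ?J" if "n \<in> {m..<M}" for n
      proof -
        have n: "n - m + 1 < L" using that by (auto simp: M_def)
        then have "g n = C (cs ! (n - m + 1))" using C[OF n] that by simp
        moreover have "cs ! (n - m + 1) \<in> ?J" by (rule nth_J[OF n])
        ultimately show ?thesis by (rule image_eqI)
      qed
      then have "g ` {..<M} \<subseteq> g ` {..<2 * h} \<union> C ` ?J"
        unfolding m_def by (metis (no_types, lifting) UnI1 UnI2 atLeastLessThan_iff
          image_subsetI image_eqI lessThan_iff not_le_imp_less)
      from mono_generate[OF this]
      show "carrier G \<subseteq> generate G ((\<lambda>k. g (2 * (k - 1))) ` {1..h} \<union>
          (\<lambda>k. g (2 * (k - 1) + 1)) ` {1..h} \<union> C ` ?J)"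
        using g_gen unfolding image_lessThan_double by blast
    qed (use xf in simp)
  qed
qed

theorem mainTheorem3:
  fixes p e f h :: nat and r x :: "nat \<Rightarrow> nat" and G :: "('a, 'b) monoid_scheme"
  assumes "prime p"
    and "group G"
    and "e \<ge> 1" and "r e \<ge> 1"
    and "G \<cong> abelian_p_group p e r"
    and "f \<ge> 1 \<Longrightarrow> x f > 0"
    and "prime_index f x = f" and "f \<le> e"
    and "p = 2 \<Longrightarrow> prime_index e r < f \<Longrightarrow> even (x f)"
    and "\<And>i. 1 \<le> i \<Longrightarrow> i \<le> f \<Longrightarrow> 2 * h + (\<Sum>j=i..f. x j) \<ge> 1 + (\<Sum>j=i..e. r j)"
    and "2 * h \<ge> (\<Sum>j=f+1..e. r j)"
  shows "\<exists>\<phi>. smooth_epi p f x h G \<phi>"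
proof -
  let ?I = "SIGMA i:{1..e}. {1..r i}"
  obtain b where b: "comm_group G" "b \<in> ?I \<rightarrow> carrier G"
    "\<And>l. l \<in> ?I \<Longrightarrow> group.ord G (b l) = p ^ fst l"
    "carrier G \<subseteq> generate G (b ` ?I)"
    "\<And>l l' i j. l \<in> ?I \<Longrightarrow> l' \<in> ?I \<Longrightarrow> l \<noteq> l' \<Longrightarrow>
      b l [^]\<^bsub>G\<^esub> (i::nat) = b l' [^]\<^bsub>G\<^esub> (j::nat) \<Longrightarrow> b l [^]\<^bsub>G\<^esub> i = \<one>\<^bsub>G\<^esub>"
    by (rule abelian_p_group_basis[OF assms(1,2,5)]) blast
  interpret comm_group G by (fact b(1))
  show ?thesis
  proof (rule smooth_epi_exists_if_basis[where p = p and e = e and r = r])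
    show "b \<in> ?I \<rightarrow> carrier G" "carrier G \<subseteq> generate G (b ` ?I)" by fact+
    show "group.ord G (b l) = p ^ fst l" if "l \<in> ?I" for l using that by (rule b(3))
    show "b l [^]\<^bsub>G\<^esub> i = \<one>\<^bsub>G\<^esub>"
      if "l \<in> ?I" "l' \<in> ?I" "l \<noteq> l'" "b l [^]\<^bsub>G\<^esub> i = b l' [^]\<^bsub>G\<^esub> j" for l l' and i j :: nat
      using that by (rule b(5))
    show "prime p" "1 \<le> e" "1 \<le> r e" "prime_index f x = f" "f \<le> e"
      "(\<Sum>j=f+1..e. r j) \<le> 2 * h" by fact+
    show "1 + (\<Sum>j=i..e. r j) \<le> 2 * h + (\<Sum>j=i..f. x j)" if "1 \<le> i" "i \<le> f" for i
      using that by (rule assms(10))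
    show "even (x f)" if "p = 2" "prime_index e r < f"
      using that by (rule assms(9))
  qed
qed

end
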